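(* The exponential generating function $F_2(x,y)$ of connected bipartite graphs with Betti number $2$ is expressed as $F_2 = f_2(Z,W)$ with \[ f_2(z,w) = \frac{w^2}{24(1-w)^3} \big\{ (2+3w)z + 2w(6-w) \big\}. \]
   Context: For integers $r,s\ge 0$ and $k$, $N_{\rm bi}(r,s,k)$ is the number of connected bipartite simple graphs with labeled bipartition $V_1\sqcup V_2$, $|V_1|=r$, $|V_2|=s$, having exactly $r+s+k-1$ edges; equivalently, the number of connected spanning subgraphs of the complete bipartite graph $K_{r,s}$ with $r+s+k-1$ edges (so the Betti number is $k$). Conventions: if $rs=0$, then $N_{\rm bi}(r,s,k)=1$ if $k=0$ and $(r,s)\in\{(1,0),(0,1)\}$, and $0$ otherwise. It is known that $N_{\rm bi}(r,s,0)=r^{s-1}s^{r-1}$ for $r,s\ge1$. For $k\ge 0$ let $F_k(x,y) = \sum_{r,s=0}^{\infty} \frac{N_{\rm bi}(r,s,k)}{r!s!}x^r y^s$ (formal power series), and put $T:=F_0$. With the Euler operators $D_x=x\partial_x$, $D_y=y\partial_y$, put $T_x = D_xT$, $T_y=D_yT$, $Z=T_x+T_y$, $W=T_xT_y$. (Subscripts $x,y$ denote application of $D_x,D_y$, not ordinary partial derivatives.) *)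

theory Defs
  imports "HOL-Computational_Algebra.Formal_Power_Series"
begin

text \<open>
  A simple graph on a vertex set \<open>V\<close> is given by its set \<open>E\<close> of edges, each edge being a
  two-element set of vertices.
\<close>

definition adj_rel :: "'a set set \<Rightarrow> ('a \<times> 'a) set" where
  "adj_rel E = {(u, v). {u, v} \<in> E}"

definition connected_graph :: "'a set \<Rightarrow> 'a set set \<Rightarrow> bool" where
  "connected_graph V E \<longleftrightarrow> V \<noteq> {} \<and> (\<forall>u\<in>V. \<forall>v\<in>V. (u, v) \<in> (adj_rel E)\<^sup>*)"

text \<open>
  The vertices of $K_{r,s}$ are \<open>Inl i\<close> for \<open>i < r\<close> (the side $V_1$) and \<open>Inr j\<close> for \<open>j < s\<close>
  (the side $V_2$).
\<close>

definition Krs_verts :: "nat \<Rightarrow> nat \<Rightarrow> (nat + nat) set" where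
  "Krs_verts r s = {..<r} <+> {..<s}"

definition Krs_edges :: "nat \<Rightarrow> nat \<Rightarrow> (nat + nat) set set" where
  "Krs_edges r s = {{Inl i, Inr j} | i j. i < r \<and> j < s}"

definition N_bi :: "nat \<Rightarrow> nat \<Rightarrow> int \<Rightarrow> nat" where
  "N_bi r s k =
     (if r * s = 0 then (if k = 0 \<and> (r, s) \<in> {(1, 0), (0, 1)} then 1 else 0)
      else card {E. E \<subseteq> Krs_edges r s \<and> connected_graph (Krs_verts r s) E \<and>
                    int (card E) = int r + int s + k - 1})"

text \<open>
  The ring $\mathbb{Q}[[x,y]]$ is represented as $(\mathbb{Q}[[y]])[[x]]$, i.e. the coefficient
  of $x^r y^s$ in \<open>A\<close> is \<open>fps_nth (fps_nth A r) s\<close>.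
\<close>

definition F_bi :: "nat \<Rightarrow> rat fps fps" where
  "F_bi k = Abs_fps (\<lambda>r. Abs_fps (\<lambda>s. of_nat (N_bi r s (int k)) / (fact r * fact s)))"

definition Dx :: "rat fps fps \<Rightarrow> rat fps fps" where
  "Dx A = fps_X * fps_deriv A"

definition Dy :: "rat fps fps \<Rightarrow> rat fps fps" where
  "Dy A = Abs_fps (\<lambda>r. fps_X * fps_deriv (fps_nth A r))"

definition T_ser :: "rat fps fps" where
  "T_ser = F_bi 0"

definition Z_ser :: "rat fps fps" where
  "Z_ser = Dx T_ser + Dy T_ser"

definition W_ser :: "rat fps fps" where
  "W_ser = Dx T_ser * Dy T_ser"

text \<open>
  The rational function $f_2$, evaluated in $\mathbb{Q}[[x,y]]$.  The denominator is meant to be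
  a unit of $\mathbb{Q}[[x,y]]$; for $w = W$ this is the case by \<open>f2_denominator_unit\<close> below.
\<close>

definition f2 :: "rat fps fps \<Rightarrow> rat fps fps \<Rightarrow> rat fps fps" where
  "f2 z w = w\<^sup>2 / (24 * (1 - w) ^ 3) * ((2 + 3 * w) * z + 2 * w * (6 - w))"

lemma f2_denominator_unit: "f2 z W_ser * (24 * (1 - W_ser) ^ 3)
    = W_ser\<^sup>2 * ((2 + 3 * W_ser) * z + 2 * W_ser * (6 - W_ser))"
proof -
  let ?d = "24 * (1 - W_ser) ^ 3"
  have d0: "fps_nth ?d 0 = 24"
    by (simp add: W_ser_def Dx_def fps_power_zeroth numeral_fps_const)
  moreover have "(24 :: rat fps) * inverse 24 = 1"
    by (simp add: inverse_mult_eq_1' numeral_fps_const)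
  ultimately have u: "fps_nth ?d 0 * inverse (fps_nth ?d 0) = 1" by simp
  have nz: "fps_nth ?d 0 \<noteq> 0" unfolding d0 by simp
  have inv: "?d * inverse ?d = 1"
    by (subst fps_inverse_def) (rule fps_right_inverse[OF u])
  have "a / ?d = a * inverse ?d" for a
    by (rule fps_divide_unit[OF nz])
  then have "f2 z W_ser * ?d = W_ser\<^sup>2 * ((2 + 3 * W_ser) * z + 2 * W_ser * (6 - W_ser)) * (?d * inverse ?d)"
    by (simp add: f2_def mult_ac)
  then show ?thesis by (simp only: inv mult_1_right)
qed

end

(* Deleting an edge of a connected bipartite graph leaves a connected graph or a pair of connected
   graphs, which gives
     (Dx + Dy + k - 1) F_k = (Dx Dy - Dx - Dy - k + 2) F_(k-1) + sum_(i<=k) Dx F_i * Dy F_(k-i).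
   Let a = Dx T, b = Dy T, W = a b and L = (1 - b) Dx + (1 - a) Dy.  The case k = 0 reads
   T = a + b - W.  Differentiating it shows that R = Dx a - a - a Dy a satisfies L R = m R with
   m - 1 in the maximal ideal, so R = 0 because R has no terms of degree 1.  Hence, with v = 1/(1 - W),
     Dx a = a v,  Dy a = Dx b = W v = v - 1,  Dy b = b v.
   The derivation L thus acts on polynomials in a, b, v, and the cases k = 1, 2 become
     L F_1 = v - 1 - W  and  (L + 1) F_2 = (Dx Dy - Dx - Dy) F_1 + Dx F_1 * Dy F_1.
   L multiplies the part of lowest total degree n by n, so solutions are unique up to constants, and
   it suffices to verify 2 Dx F_1 = (v - 1)^2 (1 + a), 2 Dy F_1 = (v - 1)^2 (1 + b), and the
   formula for F_2. *)

theory Submission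
  imports Defs
begin

subsection \<open>Deleting an edge of a connected graph\<close>

lemma adj_rel_mono: "E \<subseteq> E' \<Longrightarrow> adj_rel E \<subseteq> adj_rel E'"
  by (auto simp: adj_rel_def)

lemma adj_rtrancl_mono: "E \<subseteq> E' \<Longrightarrow> (u, v) \<in> (adj_rel E)\<^sup>* \<Longrightarrow> (u, v) \<in> (adj_rel E')\<^sup>*"
  using rtrancl_mono[OF adj_rel_mono] by blast

lemma adj_rtrancl_sym: "(u, v) \<in> (adj_rel E)\<^sup>* \<Longrightarrow> (v, u) \<in> (adj_rel E)\<^sup>*"
  by (rule symD[OF sym_rtrancl]) (auto simp: adj_rel_def sym_def insert_commute)

lemma connected_graphI:
  assumes "u \<in> V" "\<And>w. w \<in> V \<Longrightarrow> (u, w) \<in> (adj_rel E)\<^sup>*"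
  shows "connected_graph V E"
  unfolding connected_graph_def using assms by (blast intro: rtrancl_trans adj_rtrancl_sym)

lemma connected_graphD:
  "connected_graph V E \<Longrightarrow> u \<in> V \<Longrightarrow> v \<in> V \<Longrightarrow> (u, v) \<in> (adj_rel E)\<^sup>*"
  by (simp add: connected_graph_def)

lemma connected_graph_mono: "connected_graph V E \<Longrightarrow> E \<subseteq> E' \<Longrightarrow> connected_graph V E'"
  using adj_rtrancl_mono[of E E'] by (auto simp: connected_graph_def)

lemma connected_graph_image:
  assumes "connected_graph V E"
  shows "connected_graph (h ` V) ((`) h ` E)"
proof -
  have "(h u, h v) \<in> (adj_rel ((`) h ` E))\<^sup>*" if "(u, v) \<in> (adj_rel E)\<^sup>*" for u v
    using that
  proof induction
    case (step y z)
    then have "h ` {y, z} \<in> (`) h ` E"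
      by (intro imageI) (simp add: adj_rel_def)
    then have "(h y, h z) \<in> adj_rel ((`) h ` E)"
      by (simp add: adj_rel_def)
    with step.IH show ?case
      by (rule rtrancl_into_rtrancl)
  qed simp
  with assms show ?thesis
    by (auto simp: connected_graph_def)
qed

text \<open>A walk that uses the deleted edge stands at \<open>u\<close> or \<open>v\<close> right
  after its last use of it, and the rest of the walk avoids the edge.\<close>

lemma reach_delete_edge:
  assumes "(u, w) \<in> (adj_rel E)\<^sup>*"
  shows "(u, w) \<in> (adj_rel (E - {{u, v}}))\<^sup>* \<or> (v, w) \<in> (adj_rel (E - {{u, v}}))\<^sup>*"
  using assms
proof induction
  case (step y z)
  show ?case
  proof (cases "{y, z} = {u, v}")
    case True
    then show ?thesis by (auto simp: doubleton_eq_iff)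
  next
    case False
    with step.hyps have "(y, z) \<in> adj_rel (E - {{u, v}})"
      by (auto simp: adj_rel_def)
    with step.IH show ?thesis by (meson rtrancl_into_rtrancl)
  qed
qed simp

text \<open>Every edge lies inside \<open>A\<close> or misses it, so a walk that starts in
  \<open>A\<close> never leaves \<open>A\<close> and never uses an edge of
  \<open>E2\<close>.\<close>

lemma reach_restrict:
  assumes "(u, w) \<in> (adj_rel E)\<^sup>*" and "u \<in> A" and "E \<subseteq> E1 \<union> E2"
    and "\<And>e. e \<in> E1 \<Longrightarrow> e \<subseteq> A" and "\<And>e. e \<in> E2 \<Longrightarrow> e \<inter> A = {}"
  shows "w \<in> A \<and> (u, w) \<in> (adj_rel E1)\<^sup>*"
  using assms(1)
proof induction
  case (step y z)
  from step.hyps have "{y, z} \<in> E1 \<union> E2" using assms(3) by (auto simp: adj_rel_def)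
  moreover have "{y, z} \<notin> E2" using assms(5)[of "{y, z}"] step.IH by auto
  ultimately have "{y, z} \<in> E1" by blast
  with step.IH assms(4)[of "{y, z}"] show ?case
    by (auto simp: adj_rel_def intro: rtrancl_into_rtrancl)
qed (simp add: assms(2))

text \<open>The first component can be read off from the union of the two edge sets; this makes
  gluing along a bridge injective.\<close>

lemma reach_component:
  assumes "connected_graph A E1" "u \<in> A"
    and "\<And>e. e \<in> E1 \<Longrightarrow> e \<subseteq> A" and "\<And>e. e \<in> E2 \<Longrightarrow> e \<inter> A = {}"
  shows "{w. (u, w) \<in> (adj_rel (E1 \<union> E2))\<^sup>*} = A"
  using reach_restrict[of u _ "E1 \<union> E2" A E1 E2] assms connected_graphD[OF assms(1,2)]
    adj_rtrancl_mono[of E1 "E1 \<union> E2"] by blast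

lemma connected_graph_join:
  assumes "connected_graph A E1" "connected_graph B E2" "u \<in> A" "v \<in> B"
  shows "connected_graph (A \<union> B) (insert {u, v} (E1 \<union> E2))"
proof (rule connected_graphI[of u])
  fix w assume w: "w \<in> A \<union> B"
  have uv: "(u, v) \<in> (adj_rel (insert {u, v} (E1 \<union> E2)))\<^sup>*"
    by (auto simp: adj_rel_def)
  show "(u, w) \<in> (adj_rel (insert {u, v} (E1 \<union> E2)))\<^sup>*"
  proof (cases "w \<in> A")
    case True
    then show ?thesis
      by (intro adj_rtrancl_mono[OF _ connected_graphD[OF assms(1,3)]]) auto
  next
    case False
    then have "(v, w) \<in> (adj_rel (insert {u, v} (E1 \<union> E2)))\<^sup>*"
      using w by (intro adj_rtrancl_mono[OF _ connected_graphD[OF assms(2,4)]]) auto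
    with uv show ?thesis by (rule rtrancl_trans)
  qed
qed (use assms in simp)

text \<open>After the deletion every vertex is reachable from \<open>u\<close> or from
  \<open>v\<close>, and \<open>v\<close> is not reachable from \<open>u\<close>, since otherwise the
  graph would still be connected. Hence \<open>A\<close> and \<open>V - A\<close> are the two
  components and no remaining edge crosses between them.\<close>

lemma connected_graph_bridge_split:
  fixes u v :: 'a
  assumes conn: "connected_graph V E" and nconn: "\<not> connected_graph V (E - {{u, v}})"
    and uv: "u \<in> V" "v \<in> V" and sub: "\<And>e. e \<in> E \<Longrightarrow> e \<subseteq> V \<and> (\<exists>x y. e = {x, y})"
  defines "E' \<equiv> E - {{u, v}}"
  defines "A \<equiv> {w \<in> V. (u, w) \<in> (adj_rel E')\<^sup>*}"
  shows "u \<in> A" "v \<in> V - A" "E' = (E' \<inter> Pow A) \<union> (E' \<inter> Pow (V - A))"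
    and "connected_graph A (E' \<inter> Pow A)" "connected_graph (V - A) (E' \<inter> Pow (V - A))"
proof -
  have reach: "(u, w) \<in> (adj_rel E')\<^sup>* \<or> (v, w) \<in> (adj_rel E')\<^sup>*" if "w \<in> V" for w
    unfolding E'_def by (rule reach_delete_edge[OF connected_graphD[OF conn uv(1) that]])
  show u: "u \<in> A" by (simp add: A_def uv)
  have nuv: "(u, v) \<notin> (adj_rel E')\<^sup>*"
    using connected_graphI[of u V E'] reach nconn uv by (metis E'_def rtrancl_trans)
  then show v: "v \<in> V - A" by (simp add: A_def uv)
  have edge: "e \<subseteq> A \<or> e \<subseteq> V - A" if e: "e \<in> E'" for e
  proof -
    obtain x y where xy: "e = {x, y}" using sub[of e] e by (auto simp: E'_def)
    have "(x, y) \<in> adj_rel E'" "(y, x) \<in> adj_rel E'"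
      using e xy by (auto simp: adj_rel_def insert_commute)
    then have "(u, x) \<in> (adj_rel E')\<^sup>* \<longleftrightarrow> (u, y) \<in> (adj_rel E')\<^sup>*"
      by (meson rtrancl_into_rtrancl)
    moreover have "x \<in> V" "y \<in> V" using sub[of e] e xy by (auto simp: E'_def)
    ultimately show ?thesis unfolding A_def xy by auto
  qed
  then show split: "E' = (E' \<inter> Pow A) \<union> (E' \<inter> Pow (V - A))" by auto
  show "connected_graph A (E' \<inter> Pow A)"
  proof (rule connected_graphI[OF u])
    fix w assume "w \<in> A"
    then have "(u, w) \<in> (adj_rel E')\<^sup>*" by (simp add: A_def)
    then show "(u, w) \<in> (adj_rel (E' \<inter> Pow A))\<^sup>*"
      using reach_restrict[of u w E' A "E' \<inter> Pow A" "E' \<inter> Pow (V - A)"] u split by blast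
  qed
  show "connected_graph (V - A) (E' \<inter> Pow (V - A))"
  proof (rule connected_graphI[OF v])
    fix w assume "w \<in> V - A"
    then have "(v, w) \<in> (adj_rel E')\<^sup>*" using reach[of w] by (auto simp: A_def)
    then show "(v, w) \<in> (adj_rel (E' \<inter> Pow (V - A)))\<^sup>*"
      using reach_restrict[of v w E' "V - A" "E' \<inter> Pow (V - A)" "E' \<inter> Pow A"] v split by blast
  qed
qed

section \<open>Counting connected bipartite graphs by their number of edges\<close>

definition Kbi :: "'a set \<Rightarrow> 'b set \<Rightarrow> ('a + 'b) set set" where
  "Kbi X Y = (\<lambda>(i, j). {Inl i, Inr j}) ` (X \<times> Y)"

text \<open>Graded by the number of edges, which drops by one under deletion. The sides are
  arbitrary sets because the components left by a deletion live on subsets of the original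
  sides.\<close>

definition conn_bi :: "'a set \<Rightarrow> 'b set \<Rightarrow> nat \<Rightarrow> ('a + 'b) set set set" where
  "conn_bi X Y m = {E. E \<subseteq> Kbi X Y \<and> connected_graph (X <+> Y) E \<and> card E = m}"

lemma Krs_edges_eq: "Krs_edges r s = Kbi {..<r} {..<s}"
  unfolding Krs_edges_def Kbi_def by force

lemma inj_on_Kbi: "inj_on (\<lambda>(i, j). {Inl i, Inr j}) S"
  by (auto simp: inj_on_def doubleton_eq_iff)

lemma finite_Kbi: "finite X \<Longrightarrow> finite Y \<Longrightarrow> finite (Kbi X Y)"
  by (simp add: Kbi_def)

lemma card_Kbi: "card (Kbi X Y) = card X * card Y"
  unfolding Kbi_def by (simp add: card_image[OF inj_on_Kbi] card_cartesian_product)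

lemma Kbi_subset: "e \<in> Kbi X Y \<Longrightarrow> e \<subseteq> X <+> Y"
  by (auto simp: Kbi_def)

lemma Kbi_disjoint: "e \<in> Kbi (X - A) (Y - B) \<Longrightarrow> e \<inter> (A <+> B) = {}"
  by (auto simp: Kbi_def)

lemma Kbi_mono: "A \<subseteq> X \<Longrightarrow> B \<subseteq> Y \<Longrightarrow> Kbi A B \<subseteq> Kbi X Y"
  by (auto simp: Kbi_def)

lemma Kbi_Int_Pow: "e \<in> Kbi X Y \<Longrightarrow> e \<subseteq> A <+> B \<Longrightarrow> e \<in> Kbi A B"
  by (auto simp: Kbi_def)

lemma finite_conn_bi: "finite X \<Longrightarrow> finite Y \<Longrightarrow> finite (conn_bi X Y m)"
  by (rule finite_subset[of _ "Pow (Kbi X Y)"]) (auto simp: conn_bi_def finite_Kbi)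

lemma conn_bi_finite: "finite X \<Longrightarrow> finite Y \<Longrightarrow> E \<in> conn_bi X Y m \<Longrightarrow> finite E"
  by (auto simp: conn_bi_def intro: finite_subset[OF _ finite_Kbi])

text \<open>Bijections between the sides transport graphs injectively. The hypotheses are symmetric,
  so two uses give equality.\<close>

lemma card_conn_bi_le:
  fixes X :: "'a set" and Y :: "'b set" and X' :: "'c set" and Y' :: "'d set"
  assumes "finite X" "finite Y" "card X = card X'" "card Y = card Y'" "finite X'" "finite Y'"
  shows "card (conn_bi X Y m) \<le> card (conn_bi X' Y' m)"
proof -
  obtain f g where fg: "bij_betw f X X'" "bij_betw g Y Y'"
    using finite_same_card_bij[OF assms(1,5,3)] finite_same_card_bij[OF assms(2,6,4)] by blast
  define h where "h = map_sum f g"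
  have inj: "inj_on h (X <+> Y)"
  proof (rule inj_onI)
    fix a b assume "a \<in> X <+> Y" "b \<in> X <+> Y" "h a = h b"
    then show "a = b"
      by (cases a; cases b)
         (auto simp: h_def inj_on_eq_iff[OF fg(1)[THEN bij_betw_imp_inj_on]]
           inj_on_eq_iff[OF fg(2)[THEN bij_betw_imp_inj_on]])
  qed
  have img: "h ` (X <+> Y) = X' <+> Y'"
  proof -
    have "h ` (X <+> Y) = f ` X <+> g ` Y"
      by (auto simp: h_def image_Un image_image Plus_def)
    then show ?thesis using fg by (simp add: bij_betw_def)
  qed
  have injP: "inj_on ((`) h) (Pow (X <+> Y))"
    by (rule inj_on_image_Pow[OF inj])
  have sub: "E \<subseteq> Pow (X <+> Y)" if "E \<in> conn_bi X Y m" for E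
    using that Kbi_subset by (auto simp: conn_bi_def)
  have "inj_on ((`) ((`) h)) (conn_bi X Y m)"
    by (rule inj_on_subset[OF inj_on_image_Pow[OF injP]]) (use sub in blast)
  moreover have "(`) ((`) h) ` conn_bi X Y m \<subseteq> conn_bi X' Y' m"
  proof
    fix E' assume "E' \<in> (`) ((`) h) ` conn_bi X Y m"
    then obtain E where E: "E \<in> conn_bi X Y m" "E' = (`) h ` E" by blast
    have "card E' = m"
      using card_image[OF inj_on_subset[OF injP sub[OF E(1)]]] E by (simp add: conn_bi_def)
    moreover have "connected_graph (X' <+> Y') E'"
      using connected_graph_image[of "X <+> Y" E h] E img by (simp add: conn_bi_def)
    moreover have "E' \<subseteq> Kbi X' Y'"
    proof
      fix e' assume "e' \<in> E'"
      then obtain i j where ij: "i \<in> X" "j \<in> Y" "e' = h ` {Inl i, Inr j}"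
        using E by (auto simp: conn_bi_def Kbi_def)
      then have "e' = {Inl (f i), Inr (g j)}" "f i \<in> X'" "g j \<in> Y'"
        using fg by (auto simp: h_def bij_betw_def)
      then show "e' \<in> Kbi X' Y'" by (auto simp: Kbi_def)
    qed
    ultimately show "E' \<in> conn_bi X' Y' m" by (simp add: conn_bi_def)
  qed
  ultimately show ?thesis
    by (rule card_inj_on_le) (simp add: finite_conn_bi assms)
qed

definition c_bi :: "nat \<Rightarrow> nat \<Rightarrow> nat \<Rightarrow> nat" where
  "c_bi r s m = card (conn_bi {..<r} {..<s} m)"

lemma card_conn_bi:
  "finite X \<Longrightarrow> finite Y \<Longrightarrow> card (conn_bi X Y m) = c_bi (card X) (card Y) m"
  unfolding c_bi_def by (intro antisym card_conn_bi_le) auto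

lemma sum_Pow_card:
  fixes f :: "nat \<Rightarrow> 'a :: semiring_1"
  assumes "finite X"
  shows "(\<Sum>A\<in>Pow X. f (card A)) = (\<Sum>k\<le>card X. of_nat (card X choose k) * f k)"
proof -
  have "(\<Sum>A\<in>Pow X. f (card A)) = (\<Sum>k\<le>card X. \<Sum>A | A \<in> Pow X \<and> card A = k. f (card A))"
    by (rule sum.group[symmetric]) (use assms in \<open>auto intro: card_mono\<close>)
  also have "\<dots> = (\<Sum>k\<le>card X. of_nat (card X choose k) * f k)"
    by (intro sum.cong refl) (use assms in \<open>simp add: n_subsets\<close>)
  finally show ?thesis .
qed

text \<open>Both sides count the pairs of a connected graph with \<open>m + 1\<close> edges and one of its edges:
  deleting the edge leaves a connected graph, or two components, of which the first
  is the one that contains the endpoint in \<open>X\<close>.\<close>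

lemma card_conn_bi_Suc:
  fixes X :: "'a set" and Y :: "'b set"
  assumes fin: "finite X" "finite Y"
  shows "Suc m * card (conn_bi X Y (Suc m)) = (card X * card Y - m) * card (conn_bi X Y m) +
    (\<Sum>(A, B)\<in>Pow X \<times> Pow Y. \<Sum>k\<le>m.
       card (conn_bi A B k) * card (conn_bi (X - A) (Y - B) (m - k)) * (card A * card (Y - B)))"
proof -
  note finE = conn_bi_finite[OF fin]
  define P where "P = (SIGMA E:conn_bi X Y (Suc m). E)"
  \<comment> \<open>The chosen edge is not a bridge in \<open>P1\<close> and is a bridge in
    \<open>P2\<close>.\<close>
  define P1 where "P1 = {(E, e) \<in> P. connected_graph (X <+> Y) (E - {e})}"
  define P2 where "P2 = {(E, e) \<in> P. \<not> connected_graph (X <+> Y) (E - {e})}"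
  have finP: "finite P"
    unfolding P_def using finE finite_conn_bi[OF fin] by blast
  have cardP: "card P = Suc m * card (conn_bi X Y (Suc m))"
    unfolding P_def by (subst card_SigmaI) (use finE finite_conn_bi[OF fin] in \<open>auto simp: conn_bi_def\<close>)
  have "P = P1 \<union> P2" "P1 \<inter> P2 = {}" by (auto simp: P1_def P2_def)
  then have split: "card P = card P1 + card P2"
    using finP by (metis card_Un_disjoint finite_Un)
  have P1: "card P1 = (card X * card Y - m) * card (conn_bi X Y m)"
  proof -
    \<comment> \<open>Putting back a missing edge inverts the deletion, so \<open>P1\<close>
      corresponds to connected graphs with \<open>m\<close> edges together with a non-edge.\<close>
    define Q where "Q = (SIGMA E:conn_bi X Y m. Kbi X Y - E)"
    have "card Q = (\<Sum>E\<in>conn_bi X Y m. card (Kbi X Y - E))"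
      unfolding Q_def by (rule card_SigmaI) (auto simp: finite_conn_bi finite_Kbi fin)
    also have "\<dots> = (\<Sum>E\<in>conn_bi X Y m. card X * card Y - m)"
    proof (rule sum.cong[OF refl])
      fix E assume E: "E \<in> conn_bi X Y m"
      show "card (Kbi X Y - E) = card X * card Y - m"
        using finE[OF E] E by (simp add: conn_bi_def card_Diff_subset card_Kbi)
    qed
    finally have "card Q = (card X * card Y - m) * card (conn_bi X Y m)" by simp
    moreover have "bij_betw (\<lambda>(E, e). (insert e E, e)) Q P1"
    proof (rule bij_betw_byWitness[where f' = "\<lambda>(E, e). (E - {e}, e)"])
      show "(\<lambda>(E, e). (insert e E, e)) ` Q \<subseteq> P1"
      proof clarify
        fix E e assume "(E, e) \<in> Q"
        then have "E \<in> conn_bi X Y m" "e \<in> Kbi X Y" "e \<notin> E" by (auto simp: Q_def)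
        then show "(insert e E, e) \<in> P1"
          using finE[of E] connected_graph_mono[of "X <+> Y" E "insert e E"]
          by (auto simp: P1_def P_def conn_bi_def)
      qed
      show "(\<lambda>(E, e). (E - {e}, e)) ` P1 \<subseteq> Q"
        using finE by (auto simp: P1_def P_def Q_def conn_bi_def)
    qed (auto simp: Q_def P1_def P_def)
    ultimately show ?thesis using bij_betw_same_card by fastforce
  qed
  have P2: "card P2 = (\<Sum>(A, B)\<in>Pow X \<times> Pow Y. \<Sum>k\<le>m.
       card (conn_bi A B k) * card (conn_bi (X - A) (Y - B) (m - k)) * (card A * card (Y - B)))"
  proof -
    \<comment> \<open>A member of \<open>S\<close> records the sides \<open>A\<close>,
      \<open>B\<close> of the component of the endpoint in \<open>X\<close>, the two components with
      \<open>m\<close> edges in all, and the endpoints of the bridge; \<open>\<phi>\<close> glues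
      them together.\<close>
    define G where "G = (\<lambda>A B. \<Union>k\<le>m. conn_bi A B k \<times> conn_bi (X - A) (Y - B) (m - k))"
    define S where "S = (SIGMA (A, B):Pow X \<times> Pow Y. G A B \<times> (A \<times> (Y - B)))"
    define \<phi> where "\<phi> = (\<lambda>((A :: 'a set, B :: 'b set), (E1, E2), (i, j)).
      (insert {Inl i, Inr j} (E1 \<union> E2), {Inl i, Inr j} :: ('a + 'b) set))"
    have finG: "finite (G A B)" if "A \<subseteq> X" "B \<subseteq> Y" for A B
      unfolding G_def using that fin by (auto intro!: finite_conn_bi intro: finite_subset)
    have cardG: "card (G A B) = (\<Sum>k\<le>m. card (conn_bi A B k) * card (conn_bi (X - A) (Y - B) (m - k)))"
      if "A \<subseteq> X" "B \<subseteq> Y" for A B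
    proof -
      have "finite A" "finite B" using that fin by (auto intro: finite_subset)
      then have "finite (conn_bi A B k \<times> conn_bi (X - A) (Y - B) (m - k))" for k
        by (simp add: finite_conn_bi fin)
      moreover have "conn_bi A B k \<inter> conn_bi A B l = {}" if "k \<noteq> l" for k l
        using that by (auto simp: conn_bi_def)
      ultimately show ?thesis unfolding G_def
        by (subst card_UN_disjoint) (simp_all add: card_cartesian_product Times_Int_Times)
    qed
    have "card S = (\<Sum>(A, B)\<in>Pow X \<times> Pow Y. card (G A B \<times> (A \<times> (Y - B))))"
      unfolding S_def using fin finG
      by (subst card_SigmaI) (auto simp: split_def intro: finite_subset intro!: finite_cartesian_product)
    also have "\<dots> = (\<Sum>(A, B)\<in>Pow X \<times> Pow Y. \<Sum>k\<le>m.
       card (conn_bi A B k) * card (conn_bi (X - A) (Y - B) (m - k)) * (card A * card (Y - B)))"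
      by (intro sum.cong refl) (auto simp: card_cartesian_product cardG sum_distrib_right)
    finally have cardS: "card S = \<dots>" .
    \<comment> \<open>The last three facts recover the tuple: the component of \<open>Inl i\<close>
      is \<open>A <+> B\<close>, and this set sorts the edges into \<open>E1\<close> and
      \<open>E2\<close>.\<close>
    have S_D: "A \<subseteq> X" "B \<subseteq> Y" "i \<in> A" "j \<in> Y - B" "E1 \<subseteq> Kbi A B" "E2 \<subseteq> Kbi (X - A) (Y - B)"
      "connected_graph (A <+> B) E1" "connected_graph ((X - A) <+> (Y - B)) E2" "card E1 + card E2 = m"
      "finite E1" "finite E2" "{Inl i, Inr j} \<notin> E1 \<union> E2"
      "{w. (Inl i, w) \<in> (adj_rel (E1 \<union> E2))\<^sup>*} = A <+> B"
      "(E1 \<union> E2) \<inter> Pow (A <+> B) = E1" "(E1 \<union> E2) - Pow (A <+> B) = E2"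
      if "((A, B), (E1, E2), (i, j)) \<in> S" for A B E1 E2 i j
    proof -
      show 1: "A \<subseteq> X" "B \<subseteq> Y" "i \<in> A" "j \<in> Y - B" "E1 \<subseteq> Kbi A B" "E2 \<subseteq> Kbi (X - A) (Y - B)"
        "connected_graph (A <+> B) E1" "connected_graph ((X - A) <+> (Y - B)) E2" "card E1 + card E2 = m"
        using that by (auto simp: S_def G_def conn_bi_def)
      show "finite E1" "finite E2"
        using 1 fin finite_Kbi by (meson finite_Diff finite_subset)+
      have E1: "e \<subseteq> A <+> B" if "e \<in> E1" for e
        using that 1 Kbi_subset[of e A B] by blast
      have E2: "e \<inter> (A <+> B) = {}" "e \<noteq> {}" if "e \<in> E2" for e
        using that 1 Kbi_disjoint[of e X A Y B] by (auto simp: Kbi_def)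
      show "{Inl i, Inr j} \<notin> E1 \<union> E2"
        using E1[of "{Inl i, Inr j}"] E2[of "{Inl i, Inr j}"] 1 by auto
      show "{w. (Inl i, w) \<in> (adj_rel (E1 \<union> E2))\<^sup>*} = A <+> B"
        using 1 E1 E2 by (intro reach_component) auto
      have "E1 \<subseteq> Pow (A <+> B)" using E1 by (simp add: subsetI)
      moreover have "E2 \<inter> Pow (A <+> B) = {}"
        using E2 by (metis Int_absorb2 PowD disjoint_iff)
      ultimately show "(E1 \<union> E2) \<inter> Pow (A <+> B) = E1" "(E1 \<union> E2) - Pow (A <+> B) = E2"
        by (simp_all add: Int_Un_distrib2 Un_Diff Int_absorb2 Diff_triv Diff_eq_empty_iff[THEN iffD2])
    qed
    have "inj_on \<phi> S"
    proof (rule inj_onI)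
      fix t t' assume t: "t \<in> S" "t' \<in> S" "\<phi> t = \<phi> t'"
      obtain A B E1 E2 i j where 1: "t = ((A, B), (E1, E2), (i, j))"
        by (metis prod.exhaust)
      obtain A' B' E1' E2' i' j' where 2: "t' = ((A', B'), (E1', E2'), (i', j'))"
        by (metis prod.exhaust)
      note D = S_D[OF t(1)[unfolded 1]] and D' = S_D[OF t(2)[unfolded 2]]
      have ij: "i = i'" "j = j'" and ins: "insert {Inl i, Inr j} (E1 \<union> E2) = insert {Inl i, Inr j} (E1' \<union> E2')"
        using t(3) by (auto simp: 1 2 \<phi>_def doubleton_eq_iff)
      have E: "E1 \<union> E2 = E1' \<union> E2'"
        using ins D(12) D'(12) ij by (metis insert_ident)
      have AB: "A <+> B = A' <+> B'" using D(13) D'(13) ij E by simp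
      have "A = {x. Inl x \<in> A <+> B}" "B = {y. Inr y \<in> A <+> B}"
        "A' = {x. Inl x \<in> A' <+> B'}" "B' = {y. Inr y \<in> A' <+> B'}" by auto
      with AB have "A = A'" "B = B'" by simp_all
      moreover have "E1 = E1'" "E2 = E2'"
        using D(14,15) D'(14,15) unfolding E AB by simp_all
      ultimately show "t = t'" using 1 2 ij by simp
    qed
    moreover have "\<phi> ` S \<subseteq> P2"
    proof
      fix t assume "t \<in> \<phi> ` S"
      then obtain A B E1 E2 i j where s: "((A, B), (E1, E2), (i, j)) \<in> S"
        and t: "t = (insert {Inl i, Inr j} (E1 \<union> E2), {Inl i, Inr j})"
        by (auto simp: \<phi>_def)
      note D = S_D[OF s]
      have V: "(A <+> B) \<union> ((X - A) <+> (Y - B)) = X <+> Y" using D(1,2) by auto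
      have "((E1 \<union> E2) \<inter> Pow (A <+> B)) \<inter> ((E1 \<union> E2) - Pow (A <+> B)) = {}"
        by blast
      then have "E1 \<inter> E2 = {}" unfolding D(14,15) .
      then have "card (insert {Inl i, Inr j} (E1 \<union> E2)) = Suc m"
        using D by (simp add: card_Un_disjoint)
      moreover have "connected_graph (X <+> Y) (insert {Inl i, Inr j} (E1 \<union> E2))"
        unfolding V[symmetric] using D by (intro connected_graph_join) auto
      moreover have "insert {Inl i, Inr j} (E1 \<union> E2) \<subseteq> Kbi X Y"
        using D Kbi_mono[of A X B Y] Kbi_mono[of "X - A" X "Y - B" Y] by (auto simp: Kbi_def)
      moreover have "\<not> connected_graph (X <+> Y) (E1 \<union> E2)"
      proof
        assume "connected_graph (X <+> Y) (E1 \<union> E2)"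
        then have "(Inl i, Inr j) \<in> (adj_rel (E1 \<union> E2))\<^sup>*"
          using D(1-4) by (intro connected_graphD) auto
        then show False using D(4,13) by blast
      qed
      moreover have "insert {Inl i, Inr j} (E1 \<union> E2) - {{Inl i, Inr j}} = E1 \<union> E2"
        using D(12) by blast
      ultimately show "t \<in> P2" unfolding t P2_def P_def conn_bi_def by simp
    qed
    moreover have "P2 \<subseteq> \<phi> ` S"
    proof clarify
      fix E e assume "(E, e) \<in> P2"
      then have E: "E \<subseteq> Kbi X Y" "connected_graph (X <+> Y) E" "card E = Suc m" "e \<in> E"
        "\<not> connected_graph (X <+> Y) (E - {e})" "finite E"
        using finE[of E] by (auto simp: P2_def P_def conn_bi_def)
      obtain i j where ij: "e = {Inl i, Inr j}" "i \<in> X" "j \<in> Y"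
        using E by (auto simp: Kbi_def)
      \<comment> \<open>For surjectivity the tuple is read off from the component \<open>U\<close>
        of \<open>Inl i\<close> after the deletion, with traces \<open>A\<close> and
        \<open>B\<close> on the two sides.\<close>
      define U where "U = {w \<in> X <+> Y. (Inl i, w) \<in> (adj_rel (E - {e}))\<^sup>*}"
      define A where "A = {x. Inl x \<in> U}"
      define B where "B = {y. Inr y \<in> U}"
      have U: "U = A <+> B"
        unfolding A_def B_def by (auto elim: sum.exhaust_sel) (metis InlI InrI mem_Collect_eq sum.exhaust)
      have AB: "A \<subseteq> X" "B \<subseteq> Y" by (auto simp: A_def B_def U_def)
      have VU: "(X <+> Y) - U = (X - A) <+> (Y - B)" unfolding U by auto
      have ijV: "Inl i \<in> X <+> Y" "Inr j \<in> X <+> Y" using ij by auto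
      have "e' \<subseteq> X <+> Y \<and> (\<exists>x y. e' = {x, y})" if "e' \<in> E" for e'
      proof -
        have e': "e' \<in> Kbi X Y" using that E(1) by blast
        then obtain x y where "e' = {Inl x, Inr y}" by (auto simp: Kbi_def)
        with Kbi_subset[OF e'] show ?thesis by blast
      qed
      note sp = connected_graph_bridge_split[OF E(2) E(5)[unfolded ij(1)] ijV this,
          folded ij(1), folded U_def, unfolded VU, unfolded U]
      let ?E1 = "(E - {e}) \<inter> Pow (A <+> B)" and ?E2 = "(E - {e}) \<inter> Pow ((X - A) <+> (Y - B))"
      have s1: "Inl i \<in> A <+> B" "Inr j \<in> (X - A) <+> (Y - B)" "E - {e} = ?E1 \<union> ?E2"
        "connected_graph (A <+> B) ?E1" "connected_graph ((X - A) <+> (Y - B)) ?E2"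
        by (rule sp, assumption)+
      have "?E1 \<inter> ?E2 = {}"
        using E(1) by (auto simp: Kbi_def)
      then have card: "card ?E1 + card ?E2 = m"
        using s1(3) E(3,4,6) card_Un_disjoint[of ?E1 ?E2] by (simp add: card_Diff_singleton)
      have "?E1 \<subseteq> Kbi A B" "?E2 \<subseteq> Kbi (X - A) (Y - B)"
        using E(1) Kbi_Int_Pow[of _ X Y A B] Kbi_Int_Pow[of _ X Y "X - A" "Y - B"] by blast+
      then have "?E1 \<in> conn_bi A B (card ?E1)" "?E2 \<in> conn_bi (X - A) (Y - B) (m - card ?E1)"
        using s1 card by (auto simp: conn_bi_def)
      moreover have "card ?E1 \<le> m" using card by simp
      ultimately have "(?E1, ?E2) \<in> G A B" unfolding G_def by blast
      then have "((A, B), (?E1, ?E2), (i, j)) \<in> S"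
        using AB s1(1,2) ij by (auto simp: S_def)
      moreover have "\<phi> ((A, B), (?E1, ?E2), (i, j)) = (E, e)"
        unfolding \<phi>_def using s1(3) E(4) ij by auto
      ultimately show "(E, e) \<in> \<phi> ` S" by (metis rev_image_eqI)
    qed
    ultimately have "bij_betw \<phi> S P2" by (auto simp: bij_betw_def)
    then show ?thesis using cardS by (simp add: bij_betw_same_card)
  qed
  show ?thesis using cardP split P1 P2 by simp
qed

text \<open>The summand depends only on the sizes of the subsets, so grouping them by size produces
  the binomial coefficients.\<close>

lemma c_bi_Suc:
  "Suc m * c_bi r s (Suc m) = (r * s - m) * c_bi r s m +
    (\<Sum>i\<le>r. \<Sum>j\<le>s. (r choose i) * (s choose j) * (i * (s - j)) *
       (\<Sum>k\<le>m. c_bi i j k * c_bi (r - i) (s - j) (m - k)))"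
proof -
  let ?X = "{..<r}" and ?Y = "{..<s}"
  define f where "f = (\<lambda>i j. i * (s - j) * (\<Sum>k\<le>m. c_bi i j k * c_bi (r - i) (s - j) (m - k)))"
  have "(\<Sum>(A, B)\<in>Pow ?X \<times> Pow ?Y. \<Sum>k\<le>m.
       card (conn_bi A B k) * card (conn_bi (?X - A) (?Y - B) (m - k)) * (card A * card (?Y - B)))
     = (\<Sum>(A, B)\<in>Pow ?X \<times> Pow ?Y. f (card A) (card B))"
  proof (rule sum.cong[OF refl], clarify)
    fix A B assume AB: "A \<subseteq> ?X" "B \<subseteq> ?Y"
    then have fin: "finite A" "finite B" by (auto intro: finite_subset)
    have "card (?X - A) = r - card A" "card (?Y - B) = s - card B"
      using AB fin by (simp_all add: card_Diff_subset)
    then show "(\<Sum>k\<le>m. card (conn_bi A B k) * card (conn_bi (?X - A) (?Y - B) (m - k)) *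
        (card A * card (?Y - B))) = f (card A) (card B)"
      using fin by (simp add: f_def card_conn_bi sum_distrib_left mult_ac)
  qed
  also have "\<dots> = (\<Sum>A\<in>Pow ?X. \<Sum>B\<in>Pow ?Y. f (card A) (card B))"
    by (simp add: sum.cartesian_product)
  also have "\<dots> = (\<Sum>i\<le>r. \<Sum>j\<le>s. (r choose i) * ((s choose j) * f i j))"
    by (simp add: sum_Pow_card[of ?Y] sum_Pow_card[of ?X "\<lambda>i. \<Sum>j\<le>s. (s choose j) * f i j", simplified]
        sum_distrib_left)
  finally show ?thesis
    using card_conn_bi_Suc[of ?X ?Y m] by (simp add: c_bi_def[symmetric] f_def mult_ac)
qed

lemma c_bi_0: "c_bi r s 0 = (if r + s = 1 then 1 else 0)"
proof -
  have "connected_graph ({..<r} <+> {..<s}) {} \<longleftrightarrow> r + s = 1"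
  proof -
    have "connected_graph V {} \<longleftrightarrow> (\<exists>v. V = {v})" for V :: "(nat + nat) set"
    proof -
      have "connected_graph V {} \<longleftrightarrow> V \<noteq> {} \<and> (\<forall>u\<in>V. \<forall>v\<in>V. u = v)"
        by (simp add: connected_graph_def adj_rel_def)
      then show ?thesis by blast
    qed
    also have "(\<exists>v. {..<r} <+> {..<s} = {v}) \<longleftrightarrow> card ({..<r} <+> {..<s}) = 1"
      by (simp add: card_1_singleton_iff)
    finally show ?thesis by (simp add: card_Plus)
  qed
  moreover have "E \<in> conn_bi {..<r} {..<s} 0 \<longleftrightarrow> E = {} \<and> connected_graph ({..<r} <+> {..<s}) {}" for E
  proof
    assume E: "E \<in> conn_bi {..<r} {..<s} 0"
    then have "card E = 0" "finite E" by (auto simp: conn_bi_def intro: conn_bi_finite[OF _ _ E])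
    with E show "E = {} \<and> connected_graph ({..<r} <+> {..<s}) {}" by (simp add: conn_bi_def)
  qed (simp add: conn_bi_def)
  ultimately have "conn_bi {..<r} {..<s} 0 = (if r + s = 1 then {{}} else {})" by auto
  then show ?thesis by (simp add: c_bi_def)
qed

text \<open>The tree bound follows from the recurrence by induction: when the edges are shared
  between two parts, at least one part has too few for its vertices.\<close>

lemma c_bi_few_edges: "Suc m < r + s \<Longrightarrow> c_bi r s m = 0"
proof (induction m arbitrary: r s rule: less_induct)
  case (less m)
  show ?case
  proof (cases m)
    case 0
    then show ?thesis using less.prems by (simp add: c_bi_0)
  next
    case (Suc n)
    have "c_bi i j k * c_bi (r - i) (s - j) (n - k) = 0"
      if "i \<le> r" "j \<le> s" "k \<le> n" for i j k
    proof (cases "Suc k < i + j")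
      case True
      then show ?thesis using less.IH[of k i j] that Suc by simp
    next
      case False
      then have "Suc (n - k) < (r - i) + (s - j)" using less.prems that Suc by linarith
      then show ?thesis using less.IH[of "n - k" "r - i" "s - j"] that Suc by simp
    qed
    moreover have "c_bi r s n = 0" using less.IH[of n r s] less.prems Suc by simp
    ultimately have "Suc n * c_bi r s (Suc n) = 0" by (subst c_bi_Suc) simp
    then show ?thesis using Suc by simp
  qed
qed

lemma c_bi_many_edges: "r * s < m \<Longrightarrow> c_bi r s m = 0"
proof -
  assume m: "r * s < m"
  have "card E \<le> r * s" if "E \<subseteq> Kbi {..<r} {..<s}" for E
    using card_mono[OF finite_Kbi that] by (simp add: card_Kbi)
  then have "E \<notin> conn_bi {..<r} {..<s} m" for E
    using m by (metis (mono_tags, lifting) conn_bi_def mem_Collect_eq not_le)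
  then have "conn_bi {..<r} {..<s} m = {}" by blast
  then show ?thesis by (simp add: c_bi_def)
qed

lemma c_bi_one_sided: "r * s = 0 \<Longrightarrow> c_bi r s (Suc m) = 0"
proof -
  assume "r * s = 0"
  then have "Kbi {..<r} {..<s} = {}" by (auto simp: Kbi_def)
  then show ?thesis by (auto simp: c_bi_def conn_bi_def)
qed

text \<open>The conventions for \<open>r * s = 0\<close> agree with the actual count: with an empty
  side there are no edges, so only a single vertex is connected. For \<open>r = s = 0\<close> the
  subtraction may truncate to 0, and both sides still vanish.\<close>

lemma N_bi_eq_c_bi: "N_bi r s (int k) = c_bi r s (r + s + k - 1)"
proof (cases "r * s = 0")
  case False
  then have "int (card E) = int r + int s + int k - 1 \<longleftrightarrow> card E = r + s + k - 1" for E :: "(nat + nat) set set"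
    by (cases r) auto
  then show ?thesis using False
    by (simp add: N_bi_def c_bi_def conn_bi_def Krs_edges_eq Krs_verts_def)
next
  case True
  show ?thesis
  proof (cases "r + s + k - 1")
    case 0
    with True show ?thesis by (auto simp: N_bi_def c_bi_0)
  next
    case (Suc n)
    with True show ?thesis by (auto simp: N_bi_def c_bi_one_sided simp del: mult_eq_0_iff)
  qed
qed

subsection \<open>Euler operators on bivariate power series\<close>

lemma fps2_eqI: "(\<And>r s. fps_nth (fps_nth A r) s = fps_nth (fps_nth B r) s) \<Longrightarrow> A = B"
  by (simp add: fps_eq_iff)

lemma Dx_nth: "fps_nth (fps_nth (Dx A) r) s = of_nat r * fps_nth (fps_nth A r) s"
  by (cases r) (simp_all add: Dx_def fps_of_nat[symmetric] del: of_nat_Suc)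

lemma Dy_nth: "fps_nth (fps_nth (Dy A) r) s = of_nat s * fps_nth (fps_nth A r) s"
  by (cases s) (simp_all add: Dy_def)

lemma fps2_mult_nth:
  fixes A B :: "'a :: comm_ring_1 fps fps"
  shows "fps_nth (fps_nth (A * B) r) s =
    (\<Sum>i\<le>r. \<Sum>j\<le>s. fps_nth (fps_nth A i) j * fps_nth (fps_nth B (r - i)) (s - j))"
  by (simp add: fps_mult_nth fps_sum_nth atLeast0AtMost)

lemma Dx_add: "Dx (A + B) = Dx A + Dx B"
  by (rule fps2_eqI) (simp add: Dx_nth algebra_simps)

lemma Dy_add: "Dy (A + B) = Dy A + Dy B"
  by (rule fps2_eqI) (simp add: Dy_nth algebra_simps)

lemma Dx_diff: "Dx (A - B) = Dx A - Dx B"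
  by (rule fps2_eqI) (simp add: Dx_nth algebra_simps)

lemma Dy_diff: "Dy (A - B) = Dy A - Dy B"
  by (rule fps2_eqI) (simp add: Dy_nth algebra_simps)

lemma Dx_mult: "Dx (A * B) = Dx A * B + A * Dx B"
  by (simp add: Dx_def algebra_simps)

text \<open>The product rule amounts to splitting the weight \<open>s\<close> as
  \<open>j + (s - j)\<close> in the convolution.\<close>

lemma Dy_mult: "Dy (A * B) = Dy A * B + A * Dy B"
proof (rule fps2_eqI)
  fix r s
  have "of_nat s * (fps_nth (fps_nth A i) j * fps_nth (fps_nth B (r - i)) (s - j)) =
    fps_nth (fps_nth (Dy A) i) j * fps_nth (fps_nth B (r - i)) (s - j) +
    fps_nth (fps_nth A i) j * fps_nth (fps_nth (Dy B) (r - i)) (s - j)" if "j \<le> s" for i j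
    using that by (simp add: Dy_nth of_nat_diff algebra_simps)
  then show "fps_nth (fps_nth (Dy (A * B)) r) s = fps_nth (fps_nth (Dy A * B + A * Dy B) r) s"
    by (simp add: Dy_nth[of "A * B"] fps2_mult_nth sum_distrib_left sum.distrib)
qed

lemma Dx_of_nat: "Dx (of_nat n) = 0"
  by (simp add: Dx_def)

lemma Dy_of_nat: "Dy (of_nat n) = 0"
proof -
  have "Dy (1 :: rat fps fps) = 0"
    by (rule fps2_eqI) (auto simp: Dy_nth fps_one_nth)
  moreover have "Dy (0 :: rat fps fps) = 0"
    by (rule fps2_eqI) (simp add: Dy_nth)
  ultimately show ?thesis by (induction n) (simp_all add: Dy_add)
qed

lemmas Dx_numeral = Dx_of_nat[of "numeral _", simplified]
  and Dy_numeral = Dy_of_nat[of "numeral _", simplified]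
  and Dx_one = Dx_of_nat[of 1, simplified]
  and Dy_one = Dy_of_nat[of 1, simplified]

lemmas D_simps = Dx_add Dy_add Dx_diff Dy_diff Dx_mult Dy_mult Dx_numeral Dy_numeral Dx_one Dy_one

lemma Dx_Dy_commute: "Dx (Dy A) = Dy (Dx A)"
  by (rule fps2_eqI) (simp add: Dx_nth Dy_nth)

section \<open>Uniqueness of solutions of Euler-type equations\<close>

lemma fps2_mult_nth_lowest:
  fixes A B :: "'a :: comm_ring_1 fps fps"
  assumes "\<And>i j. i + j < r + s \<Longrightarrow> fps_nth (fps_nth B i) j = 0"
  shows "fps_nth (fps_nth (A * B) r) s = fps_nth (fps_nth A 0) 0 * fps_nth (fps_nth B r) s"
proof -
  have "fps_nth (fps_nth A i) j * fps_nth (fps_nth B (r - i)) (s - j) =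
      (if j = 0 then if i = 0 then fps_nth (fps_nth A 0) 0 * fps_nth (fps_nth B r) s else 0 else 0)"
    if "i \<le> r" "j \<le> s" for i j
    using that assms[of "r - i" "s - j"] by auto
  then show ?thesis by (simp add: fps2_mult_nth)
qed

text \<open>The operators \<open>A * _\<close> cannot lower the total degree, and multiply the part of lowest
  total degree \<open>n\<close> by the constant term of \<open>A\<close>, whereas \<open>Dx + Dy\<close> multiplies it by \<open>n\<close>.\<close>

lemma euler_system_unique:
  assumes eqG: "Dx G + Dy G = C * G + Q * H + U * Dx G + V * Dy G"
    and eqH: "Dx H + Dy H = C' * H + Q' * G + U * Dx H + V * Dy H"
    and 0: "fps_nth (fps_nth Q 0) 0 = 0" "fps_nth (fps_nth Q' 0) 0 = 0"
      "fps_nth (fps_nth U 0) 0 = 0" "fps_nth (fps_nth V 0) 0 = 0"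
    and G: "\<And>r s. of_nat (r + s) = fps_nth (fps_nth C 0) 0 \<Longrightarrow> fps_nth (fps_nth G r) s = 0"
    and H: "\<And>r s. of_nat (r + s) = fps_nth (fps_nth C' 0) 0 \<Longrightarrow> fps_nth (fps_nth H r) s = 0"
  shows "G = 0 \<and> H = 0"
proof -
  have "fps_nth (fps_nth G r) s = 0 \<and> fps_nth (fps_nth H r) s = 0" for r s
  proof (induction "r + s" arbitrary: r s rule: less_induct)
    case less
    note low = fps2_mult_nth_lowest[of r s]
    \<comment> \<open>All coefficients of degree below \<open>r + s\<close> vanish by induction, so
      the products with \<open>Q\<close>, \<open>U\<close>, \<open>V\<close> contribute nothing and
      only the constant term of \<open>C\<close> survives. If it equals \<open>r + s\<close>,
      assumption \<open>G\<close> takes over.\<close>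
    have "of_nat (r + s) * fps_nth (fps_nth G r) s = fps_nth (fps_nth C 0) 0 * fps_nth (fps_nth G r) s"
      using arg_cong[OF eqG, of "\<lambda>A. fps_nth (fps_nth A r) s"] less 0
      by (simp add: low[of G] low[of H] low[of "Dx G"] low[of "Dy G"] Dx_nth Dy_nth distrib_right)
    moreover have "of_nat (r + s) * fps_nth (fps_nth H r) s = fps_nth (fps_nth C' 0) 0 * fps_nth (fps_nth H r) s"
      using arg_cong[OF eqH, of "\<lambda>A. fps_nth (fps_nth A r) s"] less 0
      by (simp add: low[of G] low[of H] low[of "Dx H"] low[of "Dy H"] Dx_nth Dy_nth distrib_right)
    ultimately show ?case
      using G[of r s] H[of r s] by (metis mult_cancel_right)
  qed
  then show ?thesis by (auto intro!: fps2_eqI)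
qed

lemma euler_equation_unique:
  assumes "Dx G + Dy G = C * G + U * Dx G + V * Dy G"
    and "fps_nth (fps_nth U 0) 0 = 0" "fps_nth (fps_nth V 0) 0 = 0"
    and "\<And>r s. of_nat (r + s) = fps_nth (fps_nth C 0) 0 \<Longrightarrow> fps_nth (fps_nth G r) s = 0"
  shows "G = 0"
proof -
  have "Dx 0 = 0" "Dy 0 = 0" by (rule fps2_eqI; simp add: Dx_nth Dy_nth)+
  with euler_system_unique[of G C 0 0 U V 0 0] assms show ?thesis by simp
qed

section \<open>Solving the recurrences for Betti numbers 0, 1 and 2\<close>

locale bipartite_recurrence =
  fixes T F1 F2 :: "rat fps fps"
  assumes T_rec: "Dx T + Dy T - T = Dx T * Dy T"
    and F1_rec: "Dx F1 + Dy F1 = Dx (Dy T) - Dx T - Dy T + T + Dx T * Dy F1 + Dx F1 * Dy T"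
    and F2_rec: "Dx F2 + Dy F2 + F2 = Dx (Dy F1) - Dx F1 - Dy F1
      + Dx T * Dy F2 + Dx F1 * Dy F1 + Dx F2 * Dy T"
begin

definition "a = Dx T"
definition "b = Dy T"
definition "q = Dy a"
text \<open>This turns out to be the inverse of \<open>1 - a * b\<close>; defining it through
  \<open>q\<close> avoids division.\<close>

definition "v = 1 + q"

lemma Dy_a: "Dy a = q" and Dx_b: "Dx b = q"
  by (simp_all add: q_def a_def b_def Dx_Dy_commute)

lemma const_a: "fps_nth (fps_nth a 0) 0 = 0"
  by (simp add: a_def Dx_nth)

lemma const_b: "fps_nth (fps_nth b 0) 0 = 0"
  by (simp add: b_def Dy_nth)

lemma const_q: "fps_nth (fps_nth q 0) 0 = 0"
  by (simp add: q_def Dy_nth)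

lemma T_eq: "T = a + b - a * b"
  using T_rec by (simp add: a_def b_def algebra_simps)

lemma Dx_T_rec: "Dx a + q - a = Dx a * b + a * q"
  using arg_cong[OF T_eq, of Dx] by (simp add: D_simps Dx_b a_def[symmetric] algebra_simps)

lemma Dy_T_rec: "q + Dy b - b = q * b + a * Dy b"
  using arg_cong[OF T_eq, of Dy] by (simp add: D_simps Dy_a b_def[symmetric] algebra_simps)

text \<open>Logarithmic differentiation of \<open>a = x exp b\<close> gives \<open>Dx a = a + a * q\<close>.  This is derived
  here without solving for \<open>a\<close> and \<open>b\<close>: the defect satisfies a homogeneous equation.\<close>

lemma Dx_a_defect: "Dx a - a - a * q = 0"
proof -
  define p where "p = Dx a"
  define r where "r = Dy b"
  define R where "R = p - a - a * q"
  define w where "w = a * b"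
  have e1: "p + q - a = p * b + a * q" using Dx_T_rec by (simp add: p_def)
  have e2: "q + r - b = q * b + a * r" using Dy_T_rec by (simp add: r_def)
  have Dyp: "Dy p = Dx q" by (simp add: p_def q_def Dx_Dy_commute)
  have Dxr: "Dx r = Dy q" by (simp add: r_def Dx_b[symmetric] Dx_Dy_commute)
  \<comment> \<open>Differentiating \<open>e1\<close> again expresses
    \<open>(1 - b) * Dx + (1 - a) * Dy\<close>, applied to \<open>p\<close> and \<open>q\<close>,
    without second derivatives of \<open>a\<close> and \<open>b\<close>.\<close>
  have Lp: "(1 - b) * Dx p + (1 - a) * Dy p = p + 2 * p * q"
    using arg_cong[OF e1, of Dx] by (simp add: D_simps Dx_b Dyp p_def[symmetric] algebra_simps)
  have Lq: "(1 - b) * Dx q + (1 - a) * Dy q = q + p * r + q * q"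
    using arg_cong[OF e1, of Dy] by (simp add: D_simps Dy_a Dyp r_def[symmetric] algebra_simps)
  have "(1 - b) * Dx R + (1 - a) * Dy R =
      ((1 - b) * Dx p + (1 - a) * Dy p) - ((1 - b) * p + (1 - a) * q) * (1 + q)
      - a * ((1 - b) * Dx q + (1 - a) * Dy q)"
    by (simp add: R_def D_simps Dy_a p_def[symmetric] algebra_simps)
  also have "\<dots> = p + 2 * p * q - a * (1 + q) - a * (q + p * r + q * q)"
    using e1 unfolding Lp Lq by algebra
  finally have LR: "(1 - b) * Dx R + (1 - a) * Dy R = \<dots>" .
  \<comment> \<open>With denominators cleared, \<open>p\<close>, \<open>q\<close> and
    \<open>r\<close> are their expected values plus multiples of the defect
    \<open>R\<close>.\<close>
  have P: "(1 - w) * p = a + (1 - a) * R" using e1 unfolding R_def w_def by algebra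
  have Q: "(1 - w) * q = w + (b - 1) * R" using e1 unfolding R_def w_def by algebra
  have S: "(1 - a) * (1 - w) * r = (1 - a) * b + (1 - b)^2 * R"
    using e1 e2 unfolding R_def w_def by algebra
  \<comment> \<open>\<open>M\<close> clears the denominators of \<open>P\<close>, \<open>Q\<close>
    and \<open>S\<close>. The right-hand side of \<open>LR\<close> then becomes a polynomial that
    vanishes at \<open>R = 0\<close>, and \<open>m\<close> is its cofactor.\<close>
  define M where "M = (1 - w)^2 * (1 - a)"
  define m where "m = (1 - w) * (1 - 2 * a + w - 2 * (1 - a) * (1 - b) * R)"
  have "M * (p + 2 * p * q - a * (1 + q) - a * (q + p * r + q * q)) =
      (1 - a) * ((1 - w) * ((1 - w) * p) + 2 * ((1 - w) * p) * ((1 - w) * q) - a * (1 - w)^2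
        - 2 * a * (1 - w) * ((1 - w) * q) - a * ((1 - w) * q)^2)
        - a * ((1 - w) * p) * ((1 - a) * (1 - w) * r)"
    unfolding M_def by algebra
  also have "\<dots> = m * R"
    unfolding P Q S unfolding m_def w_def by algebra
  finally have "M * ((1 - b) * Dx R + (1 - a) * Dy R) = m * R" unfolding LR .
  \<comment> \<open>Since \<open>M * (1 - b)\<close> and \<open>M * (1 - a)\<close> have constant
    term 1, the coefficients of \<open>Dx R\<close> and \<open>Dy R\<close> on the right have
    constant term 0.\<close>
  then have eq: "Dx R + Dy R = m * R + (1 - M * (1 - b)) * Dx R + (1 - M * (1 - a)) * Dy R"
    by (simp add: algebra_simps)
  \<comment> \<open>As \<open>m\<close> has constant term 1, the equation leaves degree 1
    undetermined. There \<open>Dx a\<close> and \<open>a\<close> agree because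
    \<open>a = Dx T\<close> has no pure \<open>y\<close> term, and \<open>a * q\<close> starts in
    higher degree.\<close>
  have R1: "fps_nth (fps_nth R r) s = 0" if "r + s = 1" for r s
    using that fps2_mult_nth_lowest[of r s q a] const_q
    by (auto simp: R_def p_def a_def q_def Dx_nth Dy_nth add_is_1)
  have m0: "fps_nth (fps_nth m 0) 0 = 1"
    by (simp add: m_def w_def R_def p_def Dx_nth const_a const_b)
  have "R = 0"
  proof (rule euler_equation_unique[OF eq])
    fix r s assume "of_nat (r + s) = fps_nth (fps_nth m 0) 0"
    then show "fps_nth (fps_nth R r) s = 0"
      unfolding m0 by (intro R1) (metis of_nat_eq_1_iff)
  qed (simp_all add: M_def w_def const_a const_b power2_eq_square)
  then show ?thesis by (simp add: R_def p_def)
qed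

lemma q_eq_w_v: "q = a * b * v"
  using Dx_T_rec Dx_a_defect unfolding v_def by algebra

lemma w_v: "a * b * v = v - 1"
  using q_eq_w_v by (simp add: v_def)

lemma Dx_a: "Dx a = a * v"
  using Dx_a_defect by (simp add: v_def algebra_simps)

text \<open>\<open>Dy_T_rec\<close> is linear in \<open>Dy b\<close> with coefficient
  \<open>1 - a\<close>, which can be cancelled, so no second uniqueness argument is needed.\<close>

lemma Dy_b: "Dy b = b * v"
proof -
  have "(1 - a) * (Dy b - b * v) = 0"
    using Dy_T_rec w_v q_eq_w_v unfolding v_def by algebra
  moreover have "1 - a \<noteq> 0"
    using const_a by (metis diff_0_right eq_iff_diff_eq_0 fps_one_nth zero_neq_one)
  ultimately show ?thesis by simp
qed

lemma v_w: "v * (1 - a * b) = 1"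
  using w_v by (simp add: algebra_simps)

text \<open>Differentiating \<open>v = 1 + a * b * v\<close> leaves \<open>Dx v\<close> with the
  factor \<open>1 - a * b\<close>, whose inverse is \<open>v\<close>.\<close>

lemma Dx_v: "Dx v = v^2 * (v - 1) * (1 + a)"
  using arg_cong[OF w_v, of Dx] w_v Dx_b q_eq_w_v unfolding D_simps Dx_a by algebra

lemma Dy_v: "Dy v = v^2 * (v - 1) * (1 + b)"
  using arg_cong[OF w_v, of Dy] w_v Dy_a q_eq_w_v unfolding D_simps Dy_b by algebra

lemma Dy_a': "Dy a = v - 1" and Dx_b': "Dx b = v - 1"
  using Dy_a Dx_b by (simp_all add: v_def)

lemmas D_rules = D_simps Dx_a Dy_b Dy_a' Dx_b' Dx_v Dy_v

text \<open>This combines \<open>Dx + Dy\<close> with the two extreme products of the recurrence,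
  those that pair \<open>T\<close> with the unknown series.\<close>

definition "L A = (1 - b) * Dx A + (1 - a) * Dy A"

lemma L_add: "L (A + B) = L A + L B"
  and L_diff: "L (A - B) = L A - L B"
  and L_mult: "L (A * B) = L A * B + A * L B"
  and L_one: "L 1 = 0"
  and L_numeral: "L (numeral n) = 0"
  by (simp_all add: L_def D_simps algebra_simps)

text \<open>Polynomials in \<open>a\<close>, \<open>b\<close>, \<open>v\<close> are mapped to such
  polynomials, so candidate solutions can be tested by algebra modulo \<open>w_v\<close>.\<close>

lemma L_a: "L a = a" and L_b: "L b = b" and L_v: "L v = 2 * v * (v - 1)"
  unfolding L_def D_rules using w_v by algebra+

text \<open>Up to a constant, \<open>2 * F1\<close> is log \<open>v\<close> minus
  \<open>a * b\<close>, hence not polynomial in \<open>a\<close>, \<open>b\<close>,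
  \<open>v\<close>; its derivatives are, and only they enter \<open>F2_rec\<close>. They satisfy a
  coupled linear system that the claimed values satisfy as well.\<close>

lemma F1_derivs:
  shows Dx_F1: "2 * Dx F1 = (v - 1)^2 * (1 + a)"
    and Dy_F1: "2 * Dy F1 = (v - 1)^2 * (1 + b)"
proof -
  let ?g = "(v - 1)^2 * (1 + a)" and ?h = "(v - 1)^2 * (1 + b)"
  define G where "G = 2 * Dx F1 - ?g"
  define H where "H = 2 * Dy F1 - ?h"
  have rec: "L F1 = v - 1 - a * b"
    using F1_rec T_eq unfolding a_def[symmetric] b_def[symmetric] Dx_b' L_def by algebra
  \<comment> \<open>The coupling arises because \<open>Dx\<close> also differentiates the
    coefficients \<open>1 - b\<close> and \<open>1 - a\<close> of \<open>L\<close>.\<close>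
  have "L (Dx F1) = (v - 1) * Dx F1 + a * v * Dy F1 + Dx (v - 1 - a * b)"
    using arg_cong[OF rec, of Dx] by (simp add: L_def D_rules Dx_Dy_commute algebra_simps)
  moreover have "L (Dy F1) = b * v * Dx F1 + (v - 1) * Dy F1 + Dy (v - 1 - a * b)"
    using arg_cong[OF rec, of Dy] by (simp add: L_def D_rules Dx_Dy_commute algebra_simps)
  moreover have "L ?g = (v - 1) * ?g + a * v * ?h + 2 * Dx (v - 1 - a * b)"
    unfolding L_add L_diff L_mult L_one power2_eq_square L_a L_v D_rules using w_v by algebra
  moreover have "L ?h = b * v * ?g + (v - 1) * ?h + 2 * Dy (v - 1 - a * b)"
    unfolding L_add L_diff L_mult L_one power2_eq_square L_b L_v D_rules using w_v by algebra
  ultimately have LG: "L G = (v - 1) * G + a * v * H" and LH: "L H = b * v * G + (v - 1) * H"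
    unfolding G_def H_def L_diff L_mult L_numeral by algebra+
  have eqs: "Dx G + Dy G = (v - 1) * G + a * v * H + b * Dx G + a * Dy G"
    "Dx H + Dy H = (v - 1) * H + b * v * G + b * Dx H + a * Dy H"
    using LG LH by (simp_all add: L_def algebra_simps)
  \<comment> \<open>Both diagonal coefficients \<open>v - 1\<close> have constant term 0, so only
    degree 0 needs a separate check.\<close>
  have GH0: "fps_nth (fps_nth G 0) 0 = 0" "fps_nth (fps_nth H 0) 0 = 0"
    by (simp_all add: G_def H_def v_def Dx_nth Dy_nth const_q power2_eq_square)
  have v0: "fps_nth (fps_nth (v - 1) 0) 0 = 0" by (simp add: v_def const_q)
  have "G = 0 \<and> H = 0"
    by (rule euler_system_unique[OF eqs])
       (use GH0 in \<open>simp_all add: v0 const_a const_b del: of_nat_add fps_sub_nth\<close>)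
  then show "2 * Dx F1 = ?g" "2 * Dy F1 = ?h" by (simp_all add: G_def H_def)
qed

text \<open>The candidate is the claimed closed form with \<open>1 / (1 - w)\<close> written as
  \<open>v\<close> and \<open>w * v\<close> as \<open>v - 1\<close>; for example
  \<open>v * (2 + 3 * w) = 5 * v - 3\<close>.\<close>

lemma F2_eq: "24 * F2 = (v - 1)^2 * ((5 * v - 3) * (a + b) + 12 * (v - 1) - 2 * (a * b) * (v - 1))"
proof -
  let ?f = "(v - 1)^2 * ((5 * v - 3) * (a + b) + 12 * (v - 1) - 2 * (a * b) * (v - 1))"
  define G where "G = 24 * F2 - ?f"
  have "2 * Dx (Dy F1) = Dy (2 * Dx F1)"
    by (simp add: D_simps Dx_Dy_commute)
  also have "\<dots> = (v - 1)^2 * (2 * v^2 * (1 + a) * (1 + b) + v - 1)"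
    unfolding Dx_F1 D_rules power2_eq_square by algebra
  finally have DxDy: "2 * Dx (Dy F1) = \<dots>" .
  have "L F2 + F2 = Dx (Dy F1) - Dx F1 - Dy F1 + Dx F1 * Dy F1"
    using F2_rec unfolding a_def[symmetric] b_def[symmetric] L_def by algebra
  then have "24 * (L F2 + F2) = 12 * (2 * Dx (Dy F1)) - 12 * (2 * Dx F1) - 12 * (2 * Dy F1)
      + 6 * (2 * Dx F1) * (2 * Dy F1)"
    by algebra
  also have "\<dots> = L ?f + ?f"
    unfolding DxDy Dx_F1 Dy_F1 L_add L_diff L_mult L_one L_numeral power2_eq_square L_a L_b L_v
    using w_v by algebra
  finally have "L G = - G"
    unfolding G_def L_diff L_mult L_numeral by algebra
  then have eq: "Dx G + Dy G = (-1) * G + b * Dx G + a * Dy G"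
    by (simp add: L_def algebra_simps)
  have "G = 0"
  proof (rule euler_equation_unique[OF eq])
    \<comment> \<open>No total degree equals -1, so no coefficient is left free.\<close>
    fix r s assume "of_nat (r + s) = fps_nth (fps_nth (- 1 :: rat fps fps) 0) 0"
    then have "(0 :: rat) \<le> - 1"
      by (metis fps_neg_nth fps_one_nth of_nat_0_le_iff)
    then show "fps_nth (fps_nth G r) s = 0" by simp
  qed (simp_all add: const_a const_b)
  then show ?thesis by (simp add: G_def)
qed

lemma F2_closed_form:
  defines "w \<equiv> a * b"
  shows "F2 * (24 * (1 - w)^3) = w^2 * ((2 + 3 * w) * (a + b) + 2 * w * (6 - w))"
proof -
  have "F2 * (24 * (1 - w)^3) = 24 * F2 * (1 - w)^3" by algebra
  also have "\<dots> = w^2 * ((2 + 3 * w) * (a + b) + 2 * w * (6 - w))"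
    unfolding F2_eq w_def using v_w by algebra
  finally show ?thesis .
qed

end

subsection \<open>Recurrence for the generating functions\<close>

text \<open>Spanning trees of the two parts use \<open>i + j - 1\<close> and
  \<open>i' + j' - 1\<close> edges; the remaining \<open>k\<close> edges are the Betti numbers to be
  shared out. Terms in which a part has fewer edges than a tree vanish.\<close>

lemma sum_c_bi_mult:
  assumes "0 < i + j" "0 < i' + j'"
  shows "(\<Sum>t\<le>i + j + i' + j' + k - 2. c_bi i j t * c_bi i' j' (i + j + i' + j' + k - 2 - t)) =
    (\<Sum>l\<le>k. N_bi i j (int l) * N_bi i' j' (int (k - l)))"
proof -
  define n where "n = i + j + i' + j' + k - 2"
  define d where "d = i + j - 1"
  have "(\<Sum>t\<le>n. c_bi i j t * c_bi i' j' (n - t)) = (\<Sum>t\<in>{0 + d..k + d}. c_bi i j t * c_bi i' j' (n - t))"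
  proof (rule sum.mono_neutral_right)
    show "{0 + d..k + d} \<subseteq> {..n}"
      using assms by (auto simp: n_def d_def)
    show "\<forall>t\<in>{..n} - {0 + d..k + d}. c_bi i j t * c_bi i' j' (n - t) = 0"
    proof
      fix t assume t: "t \<in> {..n} - {0 + d..k + d}"
      then consider "Suc t < i + j" | "Suc (n - t) < i' + j'"
        using assms by (fastforce simp: n_def d_def)
      then show "c_bi i j t * c_bi i' j' (n - t) = 0"
        by cases (simp_all add: c_bi_few_edges)
    qed
  qed simp
  also have "\<dots> = (\<Sum>l\<le>k. c_bi i j (l + d) * c_bi i' j' (n - (l + d)))"
    by (simp only: sum.shift_bounds_cl_nat_ivl atLeast0AtMost)
  also have "\<dots> = (\<Sum>l\<le>k. N_bi i j (int l) * N_bi i' j' (int (k - l)))"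
  proof (rule sum.cong[OF refl])
    fix l assume "l \<in> {..k}"
    then have eqs: "l + d = i + j + l - 1" "n - (l + d) = i' + j' + (k - l) - 1"
      using assms by (auto simp: n_def d_def)
    show "c_bi i j (l + d) * c_bi i' j' (n - (l + d)) = N_bi i j (int l) * N_bi i' j' (int (k - l))"
      unfolding eqs(2) unfolding eqs(1) N_bi_eq_c_bi ..
  qed
  finally show ?thesis by (simp add: n_def)
qed

text \<open>This is \<open>c_bi_Suc\<close> at \<open>m = r + s + k - 2\<close>: graphs with
  \<open>m + 1\<close> edges have Betti number \<open>k\<close>, those with \<open>m\<close> edges
  have \<open>k - 1\<close>.\<close>

lemma N_bi_recurrence:
  "(of_nat (r + s + k) - 1) * (of_nat (N_bi r s (int k)) :: rat) =
    (if k = 0 then 0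
     else (of_nat (r * s) - of_nat (r + s + k) + 2) * of_nat (N_bi r s (int (k - 1)))) +
    (\<Sum>i\<le>r. \<Sum>j\<le>s. of_nat ((r choose i) * (s choose j) * (i * (s - j)) *
       (\<Sum>l\<le>k. N_bi i j (int l) * N_bi (r - i) (s - j) (int (k - l)))))"
  (is "?lhs = ?del + ?sum")
proof -
  \<comment> \<open>In the first two cases both sides vanish; in the third the subtraction defining
    \<open>m\<close> is exact.\<close>
  consider (none) "r + s = 0" | (single) "r + s = 1" "k = 0" | (many) "0 < r + s" "2 \<le> r + s + k"
    by linarith
  then show ?thesis
  proof cases
    case none
    then show ?thesis by (simp add: N_bi_def)
  next
    case single
    then show ?thesis by (auto simp: add_is_1)
  next
    case many
    define m where "m = r + s + k - 2"
    have Sm: "Suc m = r + s + k - 1" using many unfolding m_def by linarith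
    have N: "N_bi r s (int k) = c_bi r s (Suc m)"
      unfolding N_bi_eq_c_bi Sm ..
    have "of_nat ((r * s - m) * c_bi r s m) = ?del"
    proof (cases k)
      case 0
      then show ?thesis using many c_bi_few_edges[of m r s] by (simp add: m_def)
    next
      case (Suc k')
      then have "m = r + s + (k - 1) - 1" by (simp add: m_def)
      then have N': "c_bi r s m = N_bi r s (int (k - 1))"
        unfolding N_bi_eq_c_bi by simp
      show ?thesis
      \<comment> \<open>Where the natural number \<open>r * s - m\<close> truncates, the count
        \<open>c_bi r s m\<close> is 0, so the rational formula holds too.\<close>
      proof (cases "m \<le> r * s")
        case True
        have "(of_nat m :: rat) = of_nat (r + s + k) - 2"
          using many unfolding m_def by (subst of_nat_diff) simp_all
        with True Suc N' show ?thesis by (simp add: of_nat_diff)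
      next
        case False
        then show ?thesis using c_bi_many_edges[of r s m] N' Suc by simp
      qed
    qed
    moreover have "i * (s - j) * (\<Sum>t\<le>m. c_bi i j t * c_bi (r - i) (s - j) (m - t)) =
        i * (s - j) * (\<Sum>l\<le>k. N_bi i j (int l) * N_bi (r - i) (s - j) (int (k - l)))"
      if "i \<le> r" "j \<le> s" for i j
    \<comment> \<open>A nonzero weight makes both parts nonempty, as \<open>sum_c_bi_mult\<close>
      requires.\<close>
    proof (cases "i * (s - j) = 0")
      case False
      have "i + j + (r - i) + (s - j) + k - 2 = m" using that by (simp add: m_def)
      then show ?thesis
        using False sum_c_bi_mult[of i j "r - i" "s - j" k] by simp
    qed simp
    then have "(\<Sum>i\<le>r. \<Sum>j\<le>s. (r choose i) * (s choose j) * (i * (s - j)) *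
       (\<Sum>t\<le>m. c_bi i j t * c_bi (r - i) (s - j) (m - t))) =
      (\<Sum>i\<le>r. \<Sum>j\<le>s. (r choose i) * (s choose j) * (i * (s - j)) *
       (\<Sum>l\<le>k. N_bi i j (int l) * N_bi (r - i) (s - j) (int (k - l))))"
      by (intro sum.cong refl) (simp only: mult.assoc atMost_iff)
    then have "?sum = of_nat (\<Sum>i\<le>r. \<Sum>j\<le>s. (r choose i) * (s choose j) * (i * (s - j)) *
       (\<Sum>t\<le>m. c_bi i j t * c_bi (r - i) (s - j) (m - t)))"
      by (simp only: of_nat_sum)
    moreover have "of_nat (r + s + k) - 1 = (of_nat (Suc m) :: rat)"
      using many by (simp add: m_def of_nat_diff)
    then have "?lhs = of_nat (Suc m * c_bi r s (Suc m))"
      by (simp only: N of_nat_mult)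
    ultimately show ?thesis by (simp only: c_bi_Suc of_nat_add)
  qed
qed

lemma F_bi_nth: "fps_nth (fps_nth (F_bi k) r) s = of_nat (N_bi r s (int k)) / (fact r * fact s)"
  by (simp add: F_bi_def)

text \<open>Dividing by \<open>fact r * fact s\<close> turns the binomial sum into a Cauchy product;
  the weights \<open>i\<close> and \<open>s - j\<close> come from \<open>Dx\<close> on the first
  factor and \<open>Dy\<close> on the second.\<close>

lemma F_bi_recurrence:
  "(of_nat (r + s + k) - 1) * fps_nth (fps_nth (F_bi k) r) s =
    (if k = 0 then 0
     else (of_nat (r * s) - of_nat (r + s + k) + 2) * fps_nth (fps_nth (F_bi (k - 1)) r) s) +
    (\<Sum>l\<le>k. fps_nth (fps_nth (Dx (F_bi l) * Dy (F_bi (k - l))) r) s)"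
proof -
  let ?N = "\<lambda>i j l. of_nat (N_bi i j (int l)) :: rat"
  have binom: "of_nat (n choose i) / fact n = (1 / (fact i * fact (n - i)) :: rat)" if "i \<le> n" for n i
    using that by (simp add: binomial_fact)
  have "(\<Sum>l\<le>k. fps_nth (fps_nth (Dx (F_bi l) * Dy (F_bi (k - l))) r) s) =
    (\<Sum>l\<le>k. \<Sum>i\<le>r. \<Sum>j\<le>s. of_nat (i * (s - j)) * (1 / (fact i * fact (r - i))) *
      (1 / (fact j * fact (s - j))) * (?N i j l * ?N (r - i) (s - j) (k - l)))"
    by (simp add: fps2_mult_nth Dx_nth Dy_nth F_bi_nth mult_ac)
  also have "\<dots> = (\<Sum>i\<le>r. \<Sum>j\<le>s. \<Sum>l\<le>k. of_nat (i * (s - j)) * (1 / (fact i * fact (r - i))) *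
      (1 / (fact j * fact (s - j))) * (?N i j l * ?N (r - i) (s - j) (k - l)))"
    by (subst sum.swap, rule sum.cong[OF refl], rule sum.swap)
  also have "\<dots> = (\<Sum>i\<le>r. \<Sum>j\<le>s. of_nat ((r choose i) * (s choose j) * (i * (s - j)) *
       (\<Sum>l\<le>k. N_bi i j (int l) * N_bi (r - i) (s - j) (int (k - l))))) / (fact r * fact s)"
    unfolding sum_divide_distrib
    by (intro sum.cong refl)
       (simp add: sum_distrib_left sum_divide_distrib binom[symmetric] mult_ac del: of_nat_diff)
  finally show ?thesis
    using arg_cong[OF N_bi_recurrence[of r s k], of "\<lambda>z. z / (fact r * fact s)"]
    by (simp add: F_bi_nth add_divide_distrib)
qed

interpretation bi: bipartite_recurrence "F_bi 0" "F_bi 1" "F_bi 2"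
proof
  show "Dx (F_bi 0) + Dy (F_bi 0) - F_bi 0 = Dx (F_bi 0) * Dy (F_bi 0)"
    by (rule fps2_eqI) (use F_bi_recurrence[of _ _ 0] in \<open>simp add: Dx_nth Dy_nth algebra_simps\<close>)
  show "Dx (F_bi 1) + Dy (F_bi 1) = Dx (Dy (F_bi 0)) - Dx (F_bi 0) - Dy (F_bi 0) + F_bi 0
      + Dx (F_bi 0) * Dy (F_bi 1) + Dx (F_bi 1) * Dy (F_bi 0)"
    by (rule fps2_eqI) (use F_bi_recurrence[of _ _ 1] in \<open>simp add: Dx_nth Dy_nth algebra_simps\<close>)
  show "Dx (F_bi 2) + Dy (F_bi 2) + F_bi 2 = Dx (Dy (F_bi 1)) - Dx (F_bi 1) - Dy (F_bi 1)
      + Dx (F_bi 0) * Dy (F_bi 2) + Dx (F_bi 1) * Dy (F_bi 1) + Dx (F_bi 2) * Dy (F_bi 0)"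
    by (rule fps2_eqI)
       (use F_bi_recurrence[of _ _ 2] in \<open>simp add: Dx_nth Dy_nth numeral_2_eq_2 algebra_simps\<close>)
qed

theorem theorem1p2:
  shows "F_bi 2 = f2 Z_ser W_ser"
proof -
  let ?d = "24 * (1 - W_ser) ^ 3"
  have W: "W_ser = bi.a * bi.b" and Z: "Z_ser = bi.a + bi.b"
    by (simp_all add: W_ser_def Z_ser_def T_ser_def bi.a_def bi.b_def)
  \<comment> \<open>A series with inverse \<open>v\<close> is nonzero, so the common denominator
    cancels in the integral domain.\<close>
  have "1 - W_ser \<noteq> 0" using bi.v_w unfolding W by auto
  then have "?d \<noteq> 0" by simp
  moreover have "F_bi 2 * ?d = f2 Z_ser W_ser * ?d"
    using bi.F2_closed_form f2_denominator_unit[of Z_ser] unfolding W Z by simp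
  ultimately show ?thesis by simp
qed

end
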